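(* Let $\{P_1,\ldots,P_m\}\subseteq\mathcal{P}_n$ be a linearly independent collection of permutation matrices. Let $M\in\mathbb{R}^{m\times m}$ be the positive definite matrix with $M_{i,j}=\langle P_i,P_j\rangle_{\mathrm{F}}$. Set $$\mathbf{x}=\frac{M^{-1}\mathbf{1}_m}{\langle\mathbf{1}_m,M^{-1}\mathbf{1}_m\rangle}.$$ If $x_i\geq 0$ for all $i\in\{1,\ldots,m\}$, then $\sum_{i=1}^{m}x_iP_i$ is a bistochastic matrix. Moreover, every Erdős matrix is of this form; that is, for every Erdős matrix $A\in\mathcal{B}_n$ there is a linearly independent collection $\{P_1,\ldots,P_m\}\subseteq\mathcal{P}_n$ such that, with $M\in\mathbb{R}^{m\times m}$ the matrix with entries $M_{i,j}=\langle P_i,P_j\rangle_{\mathrm{F}}$, the vector $\mathbf{x}=\frac{M^{-1}\mathbf{1}_m}{\langle\mathbf{1}_m,M^{-1}\mathbf{1}_m\rangle}$ satisfies $x_i\geq 0$ for all $i$ and $A=\sum_{i=1}^{m}x_iP_i$.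
   Context: $\mathcal{P}_n$ is the set of $n\times n$ permutation matrices. $\mathcal{B}_n$ denotes the set of $n\times n$ bistochastic matrices: real matrices with non-negative entries whose rows and columns each sum to $1$. The Frobenius inner product of real $n\times n$ matrices is $\langle A,B\rangle_{\mathrm{F}}=\mathrm{Tr}(AB^{T})$, and $\|A\|_{\mathrm{F}}^2=\langle A,A\rangle_{\mathrm{F}}$. The maximal trace of $A$ is $\mathrm{maxTrace}(A)=\max_{\sigma\in S_n}\sum_{i=1}^{n}A_{i,\sigma(i)}$, where $S_n$ is the set of permutations of $\{1,\ldots,n\}$. A matrix $A\in\mathcal{B}_n$ is an Erdős matrix if $\|A\|_{\mathrm{F}}^2=\mathrm{maxTrace}(A)$. $\mathbf{1}_m\in\mathbb{R}^m$ is the vector all of whose coordinates are $1$, and $\langle\cdot,\cdot\rangle$ (without subscript) is the usual inner product on $\mathbb{R}^m$. Linear independence is in the real vector space of $n\times n$ real matrices. *)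

theory Defs
  imports "HOL-Analysis.Analysis" "Jordan_Normal_Form.Gauss_Jordan_Elimination"
begin

(* Both libraries declare infix $.  Here it is kept for the entries of the n x n matrices of
   type real^'n^'n; the m x m Gram matrix and the vectors of length m, whose dimension has to be
   quantified existentially, are of the types mat and vec of Jordan_Normal_Form. *)
no_notation Matrix.vec_index (infixl "$" 100)

definition permutation_matrices :: "(real^'n^'n) set" where
  "permutation_matrices =
     {(\<chi> i j. if j = \<sigma> i then 1 else 0) | \<sigma>. \<sigma> permutes (UNIV :: 'n set)}"

definition bistochastic :: "(real^'n^'n) set" where
  "bistochastic = {A. (\<forall>i j. A $ i $ j \<ge> 0) \<and>
     (\<forall>i. (\<Sum>j\<in>UNIV. A $ i $ j) = 1) \<and> (\<forall>j. (\<Sum>i\<in>UNIV. A $ i $ j) = 1)}"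

definition frobenius_inner :: "real^'n^'n \<Rightarrow> real^'n^'n \<Rightarrow> real" where
  "frobenius_inner A B = trace (A ** transpose B)"

definition max_trace :: "real^'n^'n \<Rightarrow> real" where
  "max_trace A = Max {(\<Sum>i\<in>UNIV. A $ i $ \<sigma> i) | \<sigma>. \<sigma> permutes (UNIV :: 'n set)}"

definition erdos_matrix :: "real^'n^'n \<Rightarrow> bool" where
  "erdos_matrix A \<longleftrightarrow> A \<in> bistochastic \<and> frobenius_inner A A = max_trace A"

(* A collection of m matrices is a function on nat of which only the values at 0, ..., m - 1
   matter. *)
definition gram_matrix :: "nat \<Rightarrow> (nat \<Rightarrow> real^'n^'n) \<Rightarrow> real mat" where
  "gram_matrix m P = Matrix.mat m m (\<lambda>(i, j). frobenius_inner (P i) (P j))"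

definition positive_definite :: "nat \<Rightarrow> real mat \<Rightarrow> bool" where
  "positive_definite m M \<longleftrightarrow> M \<in> carrier_mat m m \<and> transpose_mat M = M \<and>
     (\<forall>v \<in> carrier_vec m. v \<noteq> 0\<^sub>v m \<longrightarrow> scalar_prod v (M *\<^sub>v v) > 0)"

definition ones_vec :: "nat \<Rightarrow> real vec" where
  "ones_vec m = Matrix.vec m (\<lambda>_. 1)"

(* mat_inverse returns None on singular matrices, so this is only meaningful if the Gram matrix
   is invertible, as it is for linearly independent P 0, ..., P (m - 1). *)
definition gram_weights :: "nat \<Rightarrow> (nat \<Rightarrow> real^'n^'n) \<Rightarrow> real vec" where
  "gram_weights m P =
     (let u = the (mat_inverse (gram_matrix m P)) *\<^sub>v ones_vec m
      in (1 / scalar_prod (ones_vec m) u) \<cdot>\<^sub>v u)"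

end

theory Submission
  imports Defs "Jordan_Normal_Form.Determinant"
begin

text \<open>
  For linearly independent \<open>P i\<close> the number \<open>scalar_prod v (M *\<^sub>v v)\<close>, with \<open>M\<close> the Gram matrix, is
  the squared norm of the combination of the \<open>P i\<close> with coefficients \<open>v\<close>, so \<open>M\<close> is positive definite.
  Its inverse then gives the all-ones vector a nonzero quadratic form, so the normalised weights sum
  to 1 (\<open>sum_gram_weights\<close>), and nonnegative weights make a convex combination of permutation matrices.

  For the converse, an Erdos matrix \<open>A\<close> is first written as a convex combination of permutation
  matrices (\<open>birkhoff\<close>), and then of affinely independent ones with positive coefficients \<open>x\<close>
  (\<open>caratheodory_affinely_independent\<close>). All rows of a permutation matrix sum to 1, so these matrices
  lie on an affine hyperplane that misses 0, and there affine independence is linear independence.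
  Now \<open>inner A A\<close> is the average, with weights \<open>x\<close>, of the numbers \<open>inner A P\<close>, and none of them exceeds
  the maximal trace. For an Erdos matrix the average equals this upper bound, hence every \<open>inner A P\<close>
  equals \<open>inner A A\<close> (\<open>erdos_inner_summand\<close>). In terms of the Gram matrix this says that \<open>M x\<close> is a
  nonzero multiple of the all-ones vector, and together with the sum 1 it determines \<open>x\<close> to be the
  vector of Gram weights (\<open>gram_weights_eqI\<close>).

  Birkhoff's theorem is obtained from the Krein-Milman theorem. The entries of a bistochastic matrix
  that lie strictly between 0 and 1 occur at least twice in each row and column in which they occur at
  all; therefore there are more of them than independent conditions on their row and column sums, and
  the matrix can be moved both ways along a line inside the polytope. An extreme point has no such
  entries.
\<close>

(* Determinant brings back the infix $ for vectors of type vec; here it stands for real^'n. *)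
no_notation Matrix.vec_index (infixl "$" 100)

section \<open>Permutation matrices and the Frobenius inner product\<close>

lemma frobenius_inner_eq_inner: "frobenius_inner A B = inner A B"
  by (simp add: frobenius_inner_def trace_def matrix_matrix_mult_def Finite_Cartesian_Product.transpose_def inner_vec_def)

lemma permutation_matrix_bistochastic:
  assumes "P \<in> permutation_matrices"
  shows "P \<in> bistochastic"
proof -
  obtain \<sigma> where \<sigma>: "\<sigma> permutes UNIV" and P: "P = (\<chi> i j. if j = \<sigma> i then 1 else 0)"
    using assms by (auto simp: permutation_matrices_def)
  have "(\<Sum>i\<in>UNIV. P $ i $ j) = 1" for j
  proof -
    have "j = \<sigma> i \<longleftrightarrow> i = inv_into UNIV \<sigma> j" for i
      using permutes_inv_eq[OF \<sigma>, of j i] by auto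
    then show ?thesis by (simp add: P)
  qed
  then show ?thesis
    by (auto simp: bistochastic_def P)
qed

lemma inner_le_max_trace:
  assumes "P \<in> permutation_matrices"
  shows "inner A P \<le> max_trace A"
proof -
  obtain \<sigma> where \<sigma>: "\<sigma> permutes UNIV" and P: "P = (\<chi> i j. if j = \<sigma> i then 1 else 0)"
    using assms by (auto simp: permutation_matrices_def)
  have "inner A P = (\<Sum>i\<in>UNIV. A $ i $ \<sigma> i)"
    by (simp add: inner_vec_def P if_distrib cong: if_cong)
  moreover have "finite {(\<Sum>i\<in>UNIV. A $ i $ \<sigma> i) | \<sigma>. \<sigma> permutes UNIV}"
    by simp
  ultimately show ?thesis
    unfolding max_trace_def using \<sigma> by (auto intro!: Max_ge)
qed

section \<open>The polytope of bistochastic matrices\<close>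

lemma convex_bistochastic: "convex bistochastic"
  by (rule convexI)
    (auto simp: bistochastic_def sum.distrib simp flip: sum_distrib_left)

lemma bistochastic_le_1:
  assumes "A \<in> bistochastic"
  shows "A $ i $ j \<le> 1"
proof -
  have "A $ i $ j \<le> (\<Sum>k\<in>UNIV. A $ i $ k)"
    using assms by (intro member_le_sum) (auto simp: bistochastic_def)
  then show ?thesis using assms by (simp add: bistochastic_def)
qed

lemma compact_bistochastic: "compact (bistochastic :: (real^'n^'n) set)"
proof -
  have "closed (bistochastic :: (real^'n^'n) set)"
    unfolding bistochastic_def
    by (intro closed_Collect_conj closed_Collect_all closed_Collect_le closed_Collect_eq
        continuous_intros)
  moreover have "bounded (bistochastic :: (real^'n^'n) set)"
  proof (rule boundedI)
    fix A :: "real^'n^'n" assume A: "A \<in> bistochastic"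
    have "inner A A = (\<Sum>i\<in>UNIV. \<Sum>j\<in>UNIV. A $ i $ j * A $ i $ j)"
      by (simp add: inner_vec_def)
    also have "\<dots> \<le> (\<Sum>i\<in>UNIV. \<Sum>j\<in>UNIV. A $ i $ j)"
      using A by (intro sum_mono mult_left_le bistochastic_le_1) (auto simp: bistochastic_def)
    also have "\<dots> = real CARD('n)"
      using A by (simp add: bistochastic_def)
    finally show "norm A \<le> sqrt (real CARD('n))"
      by (simp add: norm_eq_sqrt_inner)
  qed
  ultimately show ?thesis
    by (simp add: compact_eq_bounded_closed)
qed

section \<open>Birkhoff's theorem\<close>

lemma twice_card_image_le:
  assumes "finite F" and twice: "\<And>p. p \<in> F \<Longrightarrow> \<exists>q\<in>F. q \<noteq> p \<and> f q = f p"
  shows "2 * card (f ` F) \<le> card F"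
proof -
  have fibre: "2 \<le> card {x \<in> F. f x = y}" if y: "y \<in> f ` F" for y
  proof -
    obtain p where p: "p \<in> F" "f p = y" using y by auto
    then obtain q where "q \<in> F" "q \<noteq> p" "f q = f p" using twice by blast
    then have "{p, q} \<subseteq> {x \<in> F. f x = y}" "card {p, q} = 2" using p by auto
    then show ?thesis using card_mono[of "{x \<in> F. f x = y}" "{p, q}"] \<open>finite F\<close> by simp
  qed
  have "2 * card (f ` F) = (\<Sum>y\<in>f ` F. 2)" by simp
  also have "\<dots> \<le> (\<Sum>y\<in>f ` F. card {x \<in> F. f x = y})"
    by (intro sum_mono fibre)
  also have "\<dots> = card F"
    using sum.image_gen[OF \<open>finite F\<close>, of "\<lambda>_. 1::nat" f] by simp
  finally show ?thesis .
qed

text \<open>The position \<open>(i, j)\<close> is sent to the pair of unit vectors \<open>(axis i 1, axis j 1)\<close>. A linear relation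
  between these pairs is exactly a matrix supported on \<open>F\<close> with vanishing row and column sums. If \<open>F\<close>
  meets \<open>r\<close> rows and \<open>c\<close> columns, each at least twice, then it has at least \<open>r + c\<close> positions, but
  the pairs span a space of dimension at most \<open>r + c - 1\<close>, because row and column sums add up to the
  same total. So a nontrivial relation exists.\<close>

lemma zero_line_sums_matrix_exists:
  fixes F :: "('n::finite \<times> 'n) set"
  assumes "F \<noteq> {}"
    and rows: "\<And>p. p \<in> F \<Longrightarrow> \<exists>q\<in>F. q \<noteq> p \<and> fst q = fst p"
    and cols: "\<And>p. p \<in> F \<Longrightarrow> \<exists>q\<in>F. q \<noteq> p \<and> snd q = snd p"
  obtains D :: "real^'n^'n" where "D \<noteq> 0"
    and "\<And>i. (\<Sum>j\<in>UNIV. D $ i $ j) = 0" and "\<And>j. (\<Sum>i\<in>UNIV. D $ i $ j) = 0"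
    and "\<And>i j. (i, j) \<notin> F \<Longrightarrow> D $ i $ j = 0"
proof -
  define g :: "'n \<times> 'n \<Rightarrow> (real^'n) \<times> (real^'n)"
    where "g p = (axis (fst p) 1, axis (snd p) 1)" for p
  have inj: "inj g"
    by (auto simp: inj_def g_def axis_eq_axis prod_eq_iff)
  obtain i0 j0 where ij0: "(i0, j0) \<in> F" using \<open>F \<noteq> {}\<close> by auto
  \<comment> \<open>A spanning set of size \<open>r + c - 1\<close>: the row index is varied in a fixed column \<open>j0\<close>, then the
    column is changed; the change from \<open>j0\<close> to itself is omitted.\<close>
  define T where "T = (\<lambda>i. g (i, j0)) ` fst ` F \<union> (\<lambda>j. (0, axis j 1 - axis j0 1)) ` (snd ` F - {j0})"
  have "finite T" unfolding T_def by simp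
  have "card T \<le> card (fst ` F) + card (snd ` F - {j0})"
    unfolding T_def by (intro order.trans[OF card_Un_le] add_mono card_image_le) auto
  moreover have "card (snd ` F - {j0}) < card (snd ` F)"
    using ij0 by (intro psubset_card_mono) force+
  moreover have "2 * card (fst ` F) \<le> card F" "2 * card (snd ` F) \<le> card F"
    using rows cols by (auto intro!: twice_card_image_le)
  ultimately have card: "card T < card (g ` F)"
    using card_image[of g F] inj by (simp add: inj_on_subset)
  have "g ` F \<subseteq> span T"
  proof (rule image_subsetI)
    fix p assume p: "p \<in> F"
    have split: "g p = g (fst p, j0) + (0, axis (snd p) 1 - axis j0 1)"
      by (simp add: g_def)
    have "g (fst p, j0) \<in> span T"
      using p by (intro span_base) (auto simp: T_def)
    moreover have "(0, axis (snd p) 1 - axis j0 1) \<in> span T"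
    proof (cases "snd p = j0")
      case True then show ?thesis using span_zero[of T] by (simp add: zero_prod_def)
    next
      case False then show ?thesis using p by (intro span_base) (auto simp: T_def)
    qed
    ultimately show "g p \<in> span T" unfolding split by (rule span_add)
  qed
  then have "dependent (g ` F)"
    using independent_span_bound[OF \<open>finite T\<close>, of "g ` F"] card by linarith
  then obtain u v where v: "v \<in> g ` F" "u v \<noteq> 0" and u: "(\<Sum>v\<in>g ` F. u v *\<^sub>R v) = 0"
    unfolding dependent_finite[OF finite_imageI[OF finite]] by blast
  \<comment> \<open>The relation, extended by 0 to all positions, is the matrix.\<close>
  define w where "w p = (if p \<in> F then u (g p) else 0)" for p
  have "(\<Sum>p\<in>UNIV. w p *\<^sub>R g p) = (\<Sum>p\<in>F. u (g p) *\<^sub>R g p)"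
    by (intro sum.mono_neutral_cong_right) (auto simp: w_def)
  also have "\<dots> = 0"
    using u sum.reindex[OF inj_on_subset[OF inj], of F "\<lambda>v. u v *\<^sub>R v"] by simp
  finally have w0: "(\<Sum>i\<in>UNIV. \<Sum>j\<in>UNIV. w (i, j) *\<^sub>R g (i, j)) = 0"
    by (simp add: sum.cartesian_product)
  have row: "(\<Sum>j\<in>UNIV. w (k, j)) = 0" for k
  proof -
    have "0 = fst (\<Sum>i\<in>UNIV. \<Sum>j\<in>UNIV. w (i, j) *\<^sub>R g (i, j)) $ k"
      unfolding w0 by simp
    also have "\<dots> = (\<Sum>i\<in>UNIV. \<Sum>j\<in>UNIV. w (i, j) * (if k = i then 1 else 0))"
      by (simp add: fst_sum g_def axis_def)
    also have "\<dots> = (\<Sum>i\<in>UNIV. if k = i then \<Sum>j\<in>UNIV. w (i, j) else 0)"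
      by (intro sum.cong) auto
    finally show ?thesis by simp
  qed
  have col: "(\<Sum>i\<in>UNIV. w (i, k)) = 0" for k
  proof -
    have "0 = snd (\<Sum>i\<in>UNIV. \<Sum>j\<in>UNIV. w (i, j) *\<^sub>R g (i, j)) $ k"
      unfolding w0 by simp
    also have "\<dots> = (\<Sum>i\<in>UNIV. \<Sum>j\<in>UNIV. w (i, j) * (if k = j then 1 else 0))"
      by (simp add: snd_sum g_def axis_def)
    also have "\<dots> = (\<Sum>i\<in>UNIV. \<Sum>j\<in>UNIV. if k = j then w (i, j) else 0)"
      by (intro sum.cong) auto
    finally show ?thesis by simp
  qed
  show ?thesis
  proof (rule that[of "\<chi> i j. w (i, j)"])
    obtain i j where "(i, j) \<in> F" "v = g (i, j)" using v by auto
    then have "w (i, j) \<noteq> 0" using v by (simp add: w_def)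
    then show "(\<chi> i j. w (i, j)) \<noteq> 0" by (auto simp: Finite_Cartesian_Product.vec_eq_iff)
  qed (use row col in \<open>auto simp: w_def\<close>)
qed

text \<open>Nonnegative numbers that sum to 1 cannot include just one number strictly between 0 and 1: the others
  have to supply the missing positive amount, which is below 1.\<close>

lemma another_fractional_summand:
  fixes a :: "'i::finite \<Rightarrow> real"
  assumes "\<And>k. a k \<ge> 0" "(\<Sum>k\<in>UNIV. a k) = 1" "0 < a i" "a i < 1"
  shows "\<exists>k. k \<noteq> i \<and> 0 < a k \<and> a k < 1"
proof -
  have rest: "(\<Sum>k\<in>UNIV - {i}. a k) = 1 - a i"
    using assms(2) by (simp add: sum_diff1)
  then obtain k where k: "k \<noteq> i" "a k > 0"
    using assms(4) sum_nonpos[of "UNIV - {i}" a] by (force simp: not_less)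
  have "a k \<le> (\<Sum>k\<in>UNIV - {i}. a k)"
    using k assms(1) by (intro member_le_sum) auto
  then show ?thesis using k rest assms(3) by (auto intro!: exI[of _ k])
qed

text \<open>If some entry were strictly between 0 and 1, then \<open>zero_line_sums_matrix_exists\<close> would give a nonzero
  \<open>D\<close> on the fractional positions, and \<open>A\<close> would be the midpoint of the bistochastic matrices
  \<open>A + e D\<close> and \<open>A - e D\<close> for small \<open>e\<close>.\<close>

lemma extreme_bistochastic_entries:
  fixes A :: "real^'n^'n"
  assumes extreme: "A extreme_point_of bistochastic"
  shows "A $ i $ j = 0 \<or> A $ i $ j = 1"
proof (rule ccontr)
  assume frac: "\<not> (A $ i $ j = 0 \<or> A $ i $ j = 1)"
  have A: "A \<in> bistochastic" using extreme by (simp add: extreme_point_of_def)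
  then have nonneg: "A $ i $ j \<ge> 0" and row: "(\<Sum>k\<in>UNIV. A $ i $ k) = 1"
    and col: "(\<Sum>k\<in>UNIV. A $ k $ j) = 1" for i j
    by (auto simp: bistochastic_def)
  define F where "F = {p. 0 < A $ fst p $ snd p \<and> A $ fst p $ snd p < 1}"
  have ij: "(i, j) \<in> F"
    using frac nonneg[of i j] bistochastic_le_1[OF A, of i j] by (auto simp: F_def)
  have rows: "\<exists>q\<in>F. q \<noteq> p \<and> fst q = fst p" if "p \<in> F" for p
    using another_fractional_summand[of "\<lambda>k. A $ fst p $ k" "snd p"] that nonneg row
    by (auto simp: F_def) (metis fst_conv snd_conv)
  have cols: "\<exists>q\<in>F. q \<noteq> p \<and> snd q = snd p" if "p \<in> F" for p
    using another_fractional_summand[of "\<lambda>k. A $ k $ snd p" "fst p"] that nonneg col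
    by (auto simp: F_def) (metis fst_conv snd_conv)
  obtain D :: "real^'n^'n" where "D \<noteq> 0" and D: "\<And>i. (\<Sum>j\<in>UNIV. D $ i $ j) = 0"
    "\<And>j. (\<Sum>i\<in>UNIV. D $ i $ j) = 0" "\<And>i j. (i, j) \<notin> F \<Longrightarrow> D $ i $ j = 0"
    using zero_line_sums_matrix_exists[OF _ rows cols] ij by blast
  \<comment> \<open>Adding 1 to the denominators keeps them positive where \<open>D\<close> vanishes, and \<open>e \<bar>D\<bar> \<le> A\<close> still
    holds entrywise.\<close>
  define e where "e = Min ((\<lambda>p. A $ fst p $ snd p / (1 + \<bar>D $ fst p $ snd p\<bar>)) ` F)"
  have "e > 0"
  proof -
    have "F \<noteq> {}" using ij by auto
    then show ?thesis
      unfolding e_def by (subst Min_gr_iff) (auto simp: F_def add_pos_nonneg)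
  qed
  have small: "e * \<bar>D $ k $ l\<bar> \<le> A $ k $ l" for k l
  proof (cases "(k, l) \<in> F")
    case True
    then have "e \<le> A $ k $ l / (1 + \<bar>D $ k $ l\<bar>)"
      unfolding e_def by (intro Min_le) (auto intro!: rev_image_eqI[of "(k, l)"])
    then have "e * (1 + \<bar>D $ k $ l\<bar>) \<le> A $ k $ l"
      by (simp add: pos_le_divide_eq)
    then show ?thesis using \<open>e > 0\<close> by (simp add: algebra_simps)
  next
    case False then show ?thesis using D(3) nonneg by simp
  qed
  have "A + s *\<^sub>R D \<in> bistochastic" if s: "\<bar>s\<bar> = e" for s
  proof -
    have "0 \<le> A $ k $ l + s * D $ k $ l" for k l
    proof -
      have "- (s * D $ k $ l) \<le> \<bar>s\<bar> * \<bar>D $ k $ l\<bar>"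
        using abs_ge_minus_self[of "s * D $ k $ l"] by (simp add: abs_mult)
      then show ?thesis using small[of k l] unfolding s by linarith
    qed
    then show ?thesis
      using D row col by (simp add: bistochastic_def sum.distrib flip: sum_distrib_left)
  qed
  from this[of e] this[of "- e"]
  have "A + e *\<^sub>R D \<in> bistochastic" "A + (- e) *\<^sub>R D \<in> bistochastic"
    using \<open>e > 0\<close> by simp_all
  moreover have "midpoint (A + e *\<^sub>R D) (A + (- e) *\<^sub>R D) = A"
    by (simp add: midpoint_def flip: scaleR_2)
  moreover have "A + e *\<^sub>R D \<noteq> A + (- e) *\<^sub>R D"
    using \<open>e > 0\<close> \<open>D \<noteq> 0\<close> by (auto simp: eq_neg_iff_add_eq_0 simp flip: scaleR_left_distrib)
  ultimately show False
    using extreme midpoint_in_open_segment unfolding extreme_point_of_def by metis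
qed

lemma bistochastic_01_is_permutation_matrix:
  fixes A :: "real^'n^'n"
  assumes A: "A \<in> bistochastic" and 01: "\<And>i j. A $ i $ j = 0 \<or> A $ i $ j = 1"
  shows "A \<in> permutation_matrices"
proof -
  have nonneg: "A $ i $ j \<ge> 0" and row: "(\<Sum>k\<in>UNIV. A $ i $ k) = 1"
    and col: "(\<Sum>k\<in>UNIV. A $ k $ j) = 1" for i j
    using A by (auto simp: bistochastic_def)
  have two: "k = l" if "f k = 1" "f l = 1" "(\<Sum>k\<in>UNIV. f k) = 1" "\<And>k. f k \<ge> 0"
    for f :: "'n \<Rightarrow> real" and k l
  proof (rule ccontr)
    assume "k \<noteq> l"
    then have "2 = sum f {k, l}" using that by simp
    also have "\<dots> \<le> sum f UNIV" using that by (intro sum_mono2) auto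
    finally show False using that by simp
  qed
  have "\<exists>j. A $ i $ j = 1" for i
    using row[of i] 01[of i] by (metis sum.neutral zero_neq_one)
  then obtain \<sigma> where \<sigma>: "\<And>i. A $ i $ \<sigma> i = 1" by metis
  have eq: "A $ i $ j = (if j = \<sigma> i then 1 else 0)" for i j
  proof (cases "A $ i $ j = 1")
    case True
    then have "j = \<sigma> i"
      by (rule two[OF _ \<sigma> row nonneg])
    then show ?thesis using \<sigma> by simp
  next
    case False
    then show ?thesis using \<sigma>[of i] 01[of i j] by auto
  qed
  have "inj \<sigma>"
  proof (rule injI)
    fix k l assume "\<sigma> k = \<sigma> l"
    then have "A $ l $ \<sigma> k = 1" by (simp add: \<sigma>)
    with \<sigma>[of k] show "k = l"
      by (rule two[where f = "\<lambda>i. A $ i $ \<sigma> k", OF _ _ col nonneg])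
  qed
  then have "\<sigma> permutes UNIV"
    by (intro bij_imp_permutes) (simp_all add: bij_def finite_UNIV_inj_surj)
  moreover have "A = (\<chi> i j. if j = \<sigma> i then 1 else 0)"
    by (simp add: Finite_Cartesian_Product.vec_eq_iff eq)
  ultimately show ?thesis by (auto simp: permutation_matrices_def)
qed

text \<open>A compact convex set is the convex hull of its extreme points, and by the two preceding lemmas the
  extreme bistochastic matrices are permutation matrices.\<close>

theorem birkhoff: "bistochastic = convex hull permutation_matrices"
proof
  have "bistochastic = convex hull {A :: real^'n^'n. A extreme_point_of bistochastic}"
    by (intro Krein_Milman_Minkowski compact_bistochastic convex_bistochastic)
  also have "\<dots> \<subseteq> convex hull permutation_matrices"
  proof (intro hull_mono subsetI, unfold mem_Collect_eq)
    fix A :: "real^'n^'n" assume A: "A extreme_point_of bistochastic"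
    then have "A \<in> bistochastic" by (simp add: extreme_point_of_def)
    then show "A \<in> permutation_matrices"
      using extreme_bistochastic_entries[OF A]
      by (rule bistochastic_01_is_permutation_matrix)
  qed
  finally show "bistochastic \<subseteq> convex hull (permutation_matrices :: (real^'n^'n) set)" .
  show "convex hull permutation_matrices \<subseteq> (bistochastic :: (real^'n^'n) set)"
    using permutation_matrix_bistochastic
    by (intro hull_minimal[OF subsetI] convex_bistochastic)
qed

section \<open>Linearly independent decompositions\<close>

text \<open>A smallest \<open>S\<close> with \<open>x\<close> in its convex hull does everything at once: by Caratheodory's theorem it has at
  most \<open>aff_dim S + 1\<close> points and so is affinely independent, and a point with coefficient 0 could be
  left out.\<close>

lemma caratheodory_affinely_independent:
  fixes p :: "'a::euclidean_space set"
  assumes "x \<in> convex hull p"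
  obtains S u where "finite S" "S \<subseteq> p" "\<not> affine_dependent S"
    "\<And>v. v \<in> S \<Longrightarrow> 0 < u v" "sum u S = 1" "(\<Sum>v\<in>S. u v *\<^sub>R v) = x"
proof -
  define Q where "Q S \<longleftrightarrow> finite S \<and> S \<subseteq> p \<and> x \<in> convex hull S" for S
  have "\<exists>S. Q S"
    using assms by (subst (asm) caratheodory) (auto simp: Q_def)
  then obtain S where S: "Q S" and least: "\<And>S'. Q S' \<Longrightarrow> card S \<le> card S'"
    using exists_least_iff[of "\<lambda>k. \<exists>S. Q S \<and> card S = k"] by (metis not_less)
  have fin: "finite S" and sub: "S \<subseteq> p" and mem: "x \<in> convex hull S" using S by (auto simp: Q_def)
  have "\<not> affine_dependent S"
  proof -
    obtain S' where "finite S'" "S' \<subseteq> S" "int (card S') \<le> aff_dim S + 1" "x \<in> convex hull S'"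
      using mem by (subst (asm) caratheodory_aff_dim) auto
    moreover from this have "Q S'" using sub by (auto simp: Q_def)
    ultimately have "int (card S) \<le> aff_dim S + 1" using least[of S'] by linarith
    then show ?thesis
      using aff_dim_le_card[OF fin] fin by (simp add: affine_independent_iff_card)
  qed
  moreover obtain u where u: "\<And>v. v \<in> S \<Longrightarrow> 0 \<le> u v" "sum u S = 1" "(\<Sum>v\<in>S. u v *\<^sub>R v) = x"
    using mem by (auto simp: convex_hull_finite[OF fin])
  moreover have "0 < u v" if v: "v \<in> S" for v
  proof (rule ccontr)
    assume "\<not> 0 < u v"
    then have "u v = 0" using u(1)[OF v] by simp
    then have "sum u (S - {v}) = 1" "(\<Sum>v\<in>S - {v}. u v *\<^sub>R v) = x"
      using u fin v by (simp_all add: sum_diff1)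
    then have "x \<in> convex hull (S - {v})"
      using u(1) fin by (auto simp: convex_hull_finite)
    then have "Q (S - {v})" using fin sub by (auto simp: Q_def)
    from least[OF this] show False using card_Diff1_less[OF fin v] by simp
  qed
  ultimately show ?thesis using that fin sub by blast
qed

text \<open>Summing any one row of a linear relation between bistochastic matrices shows that its coefficients
  add up to 0, so the relation is an affine one.\<close>

lemma independent_of_affinely_independent:
  assumes "S \<subseteq> bistochastic" "finite S" "\<not> affine_dependent S"
  shows "independent S"
proof
  assume "dependent S"
  then obtain u v where v: "v \<in> S" "u v \<noteq> 0" and u: "(\<Sum>v\<in>S. u v *\<^sub>R v) = 0"
    using \<open>finite S\<close> by (auto simp: dependent_finite)
  \<comment> \<open>Any row will do; the index type is nonempty.\<close>
  fix i :: 'a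
  have "0 = (\<Sum>j\<in>UNIV. (\<Sum>v\<in>S. u v *\<^sub>R v) $ i $ j)"
    by (simp add: u)
  also have "\<dots> = (\<Sum>v\<in>S. \<Sum>j\<in>UNIV. u v * v $ i $ j)"
    by (simp add: sum.swap[of _ S])
  also have "\<dots> = (\<Sum>v\<in>S. u v)"
    using \<open>S \<subseteq> bistochastic\<close>
    by (intro sum.cong) (auto simp: bistochastic_def simp flip: sum_distrib_left)
  finally have "sum u S = 0" by simp
  then have "affine_dependent S"
    using u v \<open>finite S\<close> by (auto simp: affine_dependent_explicit_finite)
  then show False using assms(3) by simp
qed

section \<open>Gram matrices\<close>

lemma scalar_prod_sum:
  "w \<in> carrier_vec m \<Longrightarrow> scalar_prod v w = (\<Sum>i<m. vec_index v i * vec_index w i)"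
  by (auto simp: scalar_prod_def lessThan_atLeast0)

lemma gram_matrix_mult_vec:
  assumes "v \<in> carrier_vec m" "i < m"
  shows "vec_index (gram_matrix m P *\<^sub>v v) i = inner (P i) (\<Sum>j<m. vec_index v j *\<^sub>R P j)"
proof -
  have "vec_index (gram_matrix m P *\<^sub>v v) i = scalar_prod (Matrix.row (gram_matrix m P) i) v"
    using assms by (simp add: gram_matrix_def)
  also have "\<dots> = (\<Sum>j<m. inner (P i) (P j) * vec_index v j)"
    using assms by (simp add: scalar_prod_sum gram_matrix_def frobenius_inner_eq_inner)
  finally show ?thesis by (simp add: inner_sum_right mult.commute)
qed

text \<open>The quadratic form of the Gram matrix at \<open>v\<close> is the squared norm of the linear combination of the
  \<open>P i\<close> with coefficients \<open>v\<close>.\<close>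

lemma gram_matrix_positive_definite:
  assumes "inj_on P {..<m}" "independent (P ` {..<m})"
  shows "positive_definite m (gram_matrix m P)"
  unfolding positive_definite_def
proof (intro conjI ballI impI)
  show M: "gram_matrix m P \<in> carrier_mat m m" by (simp add: gram_matrix_def)
  show "transpose_mat (gram_matrix m P) = gram_matrix m P"
    by (intro eq_matI) (simp_all add: gram_matrix_def frobenius_inner_eq_inner inner_commute)
  fix v :: "real vec" assume v: "v \<in> carrier_vec m" "v \<noteq> 0\<^sub>v m"
  let ?s = "\<Sum>j<m. vec_index v j *\<^sub>R P j"
  have "scalar_prod v (gram_matrix m P *\<^sub>v v) = (\<Sum>i<m. vec_index v i * inner (P i) ?s)"
  proof -
    have "scalar_prod v (gram_matrix m P *\<^sub>v v) =
        (\<Sum>i<m. vec_index v i * vec_index (gram_matrix m P *\<^sub>v v) i)"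
      using M v(1) by (intro scalar_prod_sum mult_mat_vec_carrier)
    also have "\<dots> = (\<Sum>i<m. vec_index v i * inner (P i) ?s)"
      using v(1) by (intro sum.cong) (simp_all only: gram_matrix_mult_vec lessThan_iff)
    finally show ?thesis .
  qed
  also have "\<dots> = inner ?s ?s"
    by (simp add: inner_sum_left)
  finally have eq: "scalar_prod v (gram_matrix m P *\<^sub>v v) = inner ?s ?s" .
  have "?s \<noteq> 0"
  proof
    assume s0: "?s = 0"
    have "(\<Sum>x\<in>P ` {..<m}. vec_index v (inv_into {..<m} P x) *\<^sub>R x) = ?s"
      using assms(1) by (subst sum.reindex) (auto intro!: sum.cong)
    with s0 have "\<forall>x\<in>P ` {..<m}. vec_index v (inv_into {..<m} P x) = 0"
      using assms(2) by (auto simp: dependent_finite)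
    then have "\<forall>j<m. vec_index v j = 0" using assms(1) by auto
    then have "v = 0\<^sub>v m" using v(1) by (intro eq_vecI) auto
    then show False using v(2) by simp
  qed
  then show "scalar_prod v (gram_matrix m P *\<^sub>v v) > 0"
    unfolding eq by simp
qed

text \<open>A positive definite matrix has trivial kernel, so its determinant is nonzero and \<open>mat_inverse\<close>
  succeeds.\<close>

lemma positive_definite_inverse:
  assumes "positive_definite m M"
  obtains N where "mat_inverse M = Some N" "N * M = 1\<^sub>m m" "M * N = 1\<^sub>m m" "N \<in> carrier_mat m m"
proof -
  have M: "M \<in> carrier_mat m m" using assms by (simp add: positive_definite_def)
  have "Determinant.det M \<noteq> 0"
  proof
    assume "Determinant.det M = 0"
    then obtain v where v: "v \<in> carrier_vec m" "v \<noteq> 0\<^sub>v m" "M *\<^sub>v v = 0\<^sub>v m"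
      using det_0_iff_vec_prod_zero_field[OF M] by auto
    then have "scalar_prod v (M *\<^sub>v v) > 0" using assms by (auto simp: positive_definite_def)
    then show False using v by simp
  qed
  then have "M \<in> Units (ring_mat TYPE(real) m ())" by (rule det_non_zero_imp_unit[OF M])
  then obtain N where "mat_inverse M = Some N"
    using mat_inverse(1)[OF M, where b = "()"] by (cases "mat_inverse M") auto
  with mat_inverse(2)[OF M this] show ?thesis using that by blast
qed

text \<open>The point is that the normalising factor is nonzero; with \<open>1 / 0 = 0\<close> all weights would vanish
  otherwise. If \<open>M u\<close> is the all-ones vector, this factor is the quadratic form of \<open>M\<close> at \<open>u\<close>, which is positive because \<open>u \<noteq> 0\<close>.\<close>

lemma sum_gram_weights:
  assumes pd: "positive_definite m (gram_matrix m P)" and "m \<ge> 1"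
  shows "(\<Sum>i<m. vec_index (gram_weights m P) i) = 1"
proof -
  let ?M = "gram_matrix m P"
  obtain N where inv: "mat_inverse ?M = Some N" and MN: "?M * N = 1\<^sub>m m" and N: "N \<in> carrier_mat m m"
    using positive_definite_inverse[OF pd] by metis
  have M: "?M \<in> carrier_mat m m" using pd by (simp add: positive_definite_def)
  have one: "ones_vec m \<in> carrier_vec m" by (simp add: ones_vec_def)
  define u where "u = N *\<^sub>v ones_vec m"
  have u: "u \<in> carrier_vec m" using N one by (simp add: u_def)
  have Mu: "?M *\<^sub>v u = ones_vec m"
    using M N one MN by (simp add: u_def flip: assoc_mult_mat_vec)
  have "u \<noteq> 0\<^sub>v m"
  proof
    assume "u = 0\<^sub>v m"
    then have "?M *\<^sub>v u = 0\<^sub>v m" using M by (intro eq_vecI) auto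
    then have "vec_index (ones_vec m) 0 = 0" using \<open>m \<ge> 1\<close> by (simp add: Mu)
    then show False using \<open>m \<ge> 1\<close> by (simp add: ones_vec_def)
  qed
  then have "scalar_prod u (?M *\<^sub>v u) > 0"
    using pd u by (auto simp: positive_definite_def)
  then have pos: "scalar_prod (ones_vec m) u > 0"
    using u one unfolding Mu by (simp add: comm_scalar_prod)
  have gw: "gram_weights m P = (1 / scalar_prod (ones_vec m) u) \<cdot>\<^sub>v u"
    by (simp add: gram_weights_def inv u_def Let_def)
  have "(\<Sum>i<m. vec_index (gram_weights m P) i) = (\<Sum>i<m. vec_index u i) / scalar_prod (ones_vec m) u"
    using u by (simp add: gw sum_divide_distrib)
  also have "(\<Sum>i<m. vec_index u i) = scalar_prod (ones_vec m) u"
    using u by (simp add: scalar_prod_sum ones_vec_def)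
  finally show ?thesis using pos by simp
qed

text \<open>Applying the inverse to \<open>M x\<close>, which is \<open>c\<close> times the all-ones vector, shows that the vector to
  be normalised is \<open>x / c\<close>, whose entries sum to \<open>1 / c\<close>.\<close>

lemma gram_weights_eqI:
  assumes pd: "positive_definite m (gram_matrix m P)"
    and x: "x \<in> carrier_vec m" "(\<Sum>i<m. vec_index x i) = 1"
    and c: "gram_matrix m P *\<^sub>v x = c \<cdot>\<^sub>v ones_vec m" "c \<noteq> 0"
  shows "gram_weights m P = x"
proof -
  let ?M = "gram_matrix m P"
  obtain N where inv: "mat_inverse ?M = Some N" and NM: "N * ?M = 1\<^sub>m m" and N: "N \<in> carrier_mat m m"
    using positive_definite_inverse[OF pd] by metis
  have M: "?M \<in> carrier_mat m m" using pd by (simp add: positive_definite_def)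
  have one: "ones_vec m \<in> carrier_vec m" by (simp add: ones_vec_def)
  have "x = N *\<^sub>v (?M *\<^sub>v x)"
    using M N x NM by (simp flip: assoc_mult_mat_vec)
  also have "\<dots> = c \<cdot>\<^sub>v (N *\<^sub>v ones_vec m)"
    using N one by (simp add: c(1) mult_mat_vec)
  finally have "(1 / c) \<cdot>\<^sub>v x = N *\<^sub>v ones_vec m"
    using c(2) by (simp add: smult_smult_assoc)
  moreover have "scalar_prod (ones_vec m) ((1 / c) \<cdot>\<^sub>v x) = 1 / c"
    using x by (simp add: scalar_prod_sum ones_vec_def flip: sum_divide_distrib)
  ultimately show ?thesis
    using c(2) by (simp add: gram_weights_def inv Let_def smult_smult_assoc flip: \<open>(1 / c) \<cdot>\<^sub>v x = _\<close>)
qed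

section \<open>Erdos matrices\<close>

text \<open>\<open>inner A A\<close> is the average of the \<open>inner A Q\<close> over the decomposition of \<open>A\<close>, and it is also an upper
  bound for each of them, since it equals the maximal trace. With positive weights this forces equality
  for every summand.\<close>

lemma erdos_inner_summand:
  assumes "erdos_matrix A" "finite S" "S \<subseteq> permutation_matrices"
    "\<And>P. P \<in> S \<Longrightarrow> 0 < u P" "sum u S = 1" "(\<Sum>P\<in>S. u P *\<^sub>R P) = A" "P \<in> S"
  shows "inner P A = inner A A"
proof -
  have le: "inner A Q \<le> inner A A" if "Q \<in> S" for Q
    using assms(1,3) inner_le_max_trace[of Q A] that
    by (auto simp: erdos_matrix_def frobenius_inner_eq_inner)
  \<comment> \<open>The weighted defects are nonnegative and add up to 0.\<close>
  have "(\<Sum>Q\<in>S. u Q * (inner A A - inner A Q)) = inner A A - inner A (\<Sum>Q\<in>S. u Q *\<^sub>R Q)"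
    by (simp add: right_diff_distrib sum_subtractf inner_sum_right assms(5) flip: sum_distrib_right)
  then have "(\<Sum>Q\<in>S. u Q * (inner A A - inner A Q)) = 0"
    by (simp add: assms(6))
  moreover have "0 \<le> u Q * (inner A A - inner A Q)" if "Q \<in> S" for Q
    using le[OF that] assms(4)[OF that] by simp
  ultimately have "u P * (inner A A - inner A P) = 0"
    using sum_nonneg_eq_0_iff[OF \<open>finite S\<close>, of "\<lambda>Q. u Q * (inner A A - inner A Q)"] \<open>P \<in> S\<close> by blast
  then show ?thesis using assms(4)[OF \<open>P \<in> S\<close>] by (simp add: inner_commute)
qed

text \<open>The coefficients of any affinely independent decomposition with positive weights are the Gram weights:
  the entries of \<open>M x\<close> are the numbers \<open>inner (P i) A\<close>, all equal to \<open>inner A A\<close> by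
  \<open>erdos_inner_summand\<close>.\<close>

lemma erdos_matrix_gram_weights:
  fixes A :: "real^'n^'n"
  assumes erdos: "erdos_matrix A"
  obtains m P where "m \<ge> 1" "\<And>i. i < m \<Longrightarrow> P i \<in> permutation_matrices"
    "inj_on P {..<m}" "independent (P ` {..<m})"
    "\<And>i. i < m \<Longrightarrow> vec_index (gram_weights m P) i \<ge> 0"
    "A = (\<Sum>i<m. vec_index (gram_weights m P) i *\<^sub>R P i)"
proof -
  have A: "A \<in> bistochastic" using erdos by (simp add: erdos_matrix_def)
  then have "A \<in> convex hull permutation_matrices" by (simp only: birkhoff)
  then obtain S u where S: "finite S" "S \<subseteq> permutation_matrices" "\<not> affine_dependent S"
    and u: "\<And>v. v \<in> S \<Longrightarrow> 0 < u v" "sum u S = 1" "(\<Sum>v\<in>S. u v *\<^sub>R v) = A"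
    by (rule caratheodory_affinely_independent) blast
  obtain P where "bij_betw P {0..<card S} S"
    using ex_bij_betw_nat_finite[OF S(1)] by blast
  then have inj: "inj_on P {..<card S}" and img: "P ` {..<card S} = S"
    by (auto simp: bij_betw_def lessThan_atLeast0)
  let ?m = "card S"
  have reindex: "(\<Sum>i<?m. f (P i)) = sum f S" for f :: "real^'n^'n \<Rightarrow> 'b::comm_monoid_add"
    using sum.reindex[OF inj, of f] by (simp add: img)
  have indep: "independent (P ` {..<?m})"
    unfolding img using S permutation_matrix_bistochastic
    by (intro independent_of_affinely_independent) auto
  define x where "x = Matrix.vec ?m (\<lambda>i. u (P i))"
  have xA: "(\<Sum>i<?m. vec_index x i *\<^sub>R P i) = A"
    using reindex[of "\<lambda>v. u v *\<^sub>R v"] u(3) by (simp add: x_def)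
  have "A \<noteq> 0" using A by (auto simp: bistochastic_def)
  have "gram_weights ?m P = x"
  proof (rule gram_weights_eqI[where c = "inner A A"])
    show "positive_definite ?m (gram_matrix ?m P)"
      using inj indep by (rule gram_matrix_positive_definite)
    show x: "x \<in> carrier_vec ?m" by (simp add: x_def)
    show "(\<Sum>i<?m. vec_index x i) = 1"
      using reindex[of u] u(2) by (simp add: x_def)
    show "gram_matrix ?m P *\<^sub>v x = inner A A \<cdot>\<^sub>v ones_vec ?m"
    proof (rule eq_vecI)
      fix i assume "i < dim_vec (inner A A \<cdot>\<^sub>v ones_vec ?m)"
      then have i: "i < ?m" by (simp add: ones_vec_def)
      then have "inner (P i) A = inner A A"
        using img by (intro erdos_inner_summand[OF erdos S(1,2) u]) auto
      then show "vec_index (gram_matrix ?m P *\<^sub>v x) i = vec_index (inner A A \<cdot>\<^sub>v ones_vec ?m) i"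
        using i x by (simp add: gram_matrix_mult_vec xA ones_vec_def)
    qed (simp add: gram_matrix_def ones_vec_def)
    show "inner A A \<noteq> 0" using \<open>A \<noteq> 0\<close> by simp
  qed
  moreover have "?m \<ge> 1"
    using u(2) S(1) by (auto simp: Suc_le_eq card_gt_0_iff)
  moreover have "P i \<in> S" if "i < ?m" for i using img that by auto
  ultimately show ?thesis
    using inj indep xA S(2) u(1) by (intro that[of ?m P]) (auto simp: x_def less_imp_le)
qed

theorem proposition1p5:
  shows "(\<forall>(m::nat) (P :: nat \<Rightarrow> real^'n^'n).
            m \<ge> 1 \<and> (\<forall>i<m. P i \<in> permutation_matrices) \<and>
            inj_on P {..<m} \<and> independent (P ` {..<m}) \<longrightarrow>
            positive_definite m (gram_matrix m P) \<and>
            ((\<forall>i<m. vec_index (gram_weights m P) i \<ge> 0) \<longrightarrow>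
               (\<Sum>i<m. vec_index (gram_weights m P) i *\<^sub>R P i) \<in> bistochastic)) \<and>
         (\<forall>A :: real^'n^'n. erdos_matrix A \<longrightarrow>
            (\<exists>(m::nat) (P :: nat \<Rightarrow> real^'n^'n).
               m \<ge> 1 \<and> (\<forall>i<m. P i \<in> permutation_matrices) \<and>
               inj_on P {..<m} \<and> independent (P ` {..<m}) \<and>
               (\<forall>i<m. vec_index (gram_weights m P) i \<ge> 0) \<and>
               A = (\<Sum>i<m. vec_index (gram_weights m P) i *\<^sub>R P i)))"
proof (intro conjI allI impI; (elim conjE)?)
  fix m and P :: "nat \<Rightarrow> real^'n^'n"
  assume m: "m \<ge> 1" and perm: "\<forall>i<m. P i \<in> permutation_matrices"
    and indep: "inj_on P {..<m}" "independent (P ` {..<m})"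
  show pd: "positive_definite m (gram_matrix m P)"
    using indep by (rule gram_matrix_positive_definite)
  assume "\<forall>i<m. vec_index (gram_weights m P) i \<ge> 0"
  then show "(\<Sum>i<m. vec_index (gram_weights m P) i *\<^sub>R P i) \<in> bistochastic"
    using sum_gram_weights[OF pd m] perm
    by (intro convex_sum convex_bistochastic) (auto intro: permutation_matrix_bistochastic)
next
  fix A :: "real^'n^'n"
  assume "erdos_matrix A"
  then obtain m P where "m \<ge> 1" "\<And>i. i < m \<Longrightarrow> P i \<in> permutation_matrices"
    "inj_on P {..<m}" "independent (P ` {..<m})"
    "\<And>i. i < m \<Longrightarrow> vec_index (gram_weights m P) i \<ge> 0"
    "A = (\<Sum>i<m. vec_index (gram_weights m P) i *\<^sub>R P i)"
    by (rule erdos_matrix_gram_weights) blast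
  then show "\<exists>(m::nat) (P :: nat \<Rightarrow> real^'n^'n).
      m \<ge> 1 \<and> (\<forall>i<m. P i \<in> permutation_matrices) \<and>
      inj_on P {..<m} \<and> independent (P ` {..<m}) \<and>
      (\<forall>i<m. vec_index (gram_weights m P) i \<ge> 0) \<and>
      A = (\<Sum>i<m. vec_index (gram_weights m P) i *\<^sub>R P i)"
    by (intro exI[of _ m] exI[of _ P] conjI allI impI)
qed

end
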